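(* Let $p$ be a prime, let $A$ be a finite abelian $p$-group with $|A| > 1$, let $N, r \in \mathbb{N}$, and let $f_1, \ldots, f_r : A^N \to A$ be functions with $$N > \sum_{i=1}^r \operatorname{Fdeg}(f_i).$$ Then $p$ divides $|V(f_1,\ldots,f_r)|$, where $V(f_1,\ldots,f_r) := \{ \mathbf{a} \in A^N \mid f_1(\mathbf{a}) = \cdots = f_r(\mathbf{a}) = 0\}$.
   Context: $\mathbb{N}$ is the set of positive integers, $\mathbb{N}_0 = \mathbb{N} \cup \{0\}$; abelian groups are written additively. For an abelian group $A$, $\mathbb{Z}[A]$ is the integral group ring; its elements are written as finite sums $\sum_{a\in A} z_a \tau_a$ with $z_a \in \mathbb{Z}$, and $\tau_a \cdot \tau_b = \tau_{a+b}$. The augmentation ideal $\operatorname{Aug}(\mathbb{Z}[A])$ is the ideal of $\mathbb{Z}[A]$ generated by $\{\tau_a - 1 \mid a \in A\}$. For an ideal $I$, $I^0 = \mathbb{Z}[A]$ and $I^n$ is the ideal generated by all products $i_1\cdots i_n$ with $i_1,\ldots,i_n \in I$. For an abelian group $B$, the ring $\mathbb{Z}[A]$ acts on the group $B^A$ of all functions $f : A \to B$ by $((\sum_{a} z_a \tau_a) * f)(x) = \sum_{a} z_a f(x+a)$. For an ideal $J$, $J * f = 0$ means $j * f = 0$ for all $j \in J$. Functional degree: for a function $f : A \to B$ between abelian groups and $I := \operatorname{Aug}(\mathbb{Z}[A])$, $\operatorname{Fdeg}(f) := \min\{ n \in \mathbb{N}_0 \mid I^{n+1} * f = 0\}$,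 with $\operatorname{Fdeg}(f) = \infty$ if no such $n$ exists. Here the functional degree of $f_i$ is taken with respect to the groups $A^N$ (domain) and $A$ (codomain). *)

theory Defs
  imports
    "HOL-Analysis.Finite_Cartesian_Product"
    "HOL-Library.Poly_Mapping"
    "HOL-Library.Extended_Nat"
    "HOL-Computational_Algebra.Primes"
begin

text \<open>The library's convolution product makes \<open>'a \<Rightarrow>\<^sub>0 int\<close> the integral group ring of \<open>'a\<close>;
  its unit is \<open>single 0 1\<close>.\<close>

type_synonym 'a group_ring = "'a \<Rightarrow>\<^sub>0 int"

abbreviation tau :: "'a \<Rightarrow> 'a group_ring"
  where "tau a \<equiv> Poly_Mapping.single a 1"

text \<open>Ideals of a commutative ring are its submodules, so the ideal generated by a set is its
  span with respect to multiplication.\<close>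

definition ideal_generated :: "'r::comm_ring_1 set \<Rightarrow> 'r set"
  where "ideal_generated S = module.span (*) S"

definition Aug :: "'a::ab_group_add group_ring set"
  where "Aug = ideal_generated {tau a - 1 | a. True}"

definition ideal_power :: "'r::comm_ring_1 set \<Rightarrow> nat \<Rightarrow> 'r set"
  where "ideal_power I n =
    (if n = 0 then UNIV else ideal_generated {\<Prod>k<n. x k | x. \<forall>k<n. x k \<in> I})"

definition int_mult :: "int \<Rightarrow> 'b::ab_group_add \<Rightarrow> 'b"
  where "int_mult z b = (if z \<ge> 0 then (\<Sum>_<nat z. b) else - (\<Sum>_<nat (- z). b))"

definition act :: "'a::ab_group_add group_ring \<Rightarrow> ('a \<Rightarrow> 'b::ab_group_add) \<Rightarrow> 'a \<Rightarrow> 'b"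
  where "act z f =
    (\<lambda>x. \<Sum>a\<in>Poly_Mapping.keys z. int_mult (Poly_Mapping.lookup z a) (f (x + a)))"

definition annihilates :: "'a::ab_group_add group_ring set \<Rightarrow> ('a \<Rightarrow> 'b::ab_group_add) \<Rightarrow> bool"
  where "annihilates J f \<longleftrightarrow> (\<forall>j\<in>J. act j f = (\<lambda>_. 0))"

definition Fdeg :: "('a::ab_group_add \<Rightarrow> 'b::ab_group_add) \<Rightarrow> enat"
  where "Fdeg f =
    (if \<exists>n. annihilates (ideal_power Aug (n + 1)) f
     then enat (LEAST n. annihilates (ideal_power Aug (n + 1)) f) else \<infinity>)"

end

theory Submission
  imports Defs "HOL-Number_Theory.Cong"
begin

text \<open>Let \<open>d + 1\<close> be the nilpotency index of the augmentation ideal of the group ring of \<open>A\<close> over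
  \<open>GF(p)\<close>, so that every function \<open>A \<rightarrow> GF(p)\<close> has degree at most \<open>d\<close>. A nonzero product of \<open>d\<close>
  elements \<open>\<tau>\<^sub>a - 1\<close> is translation invariant, hence a nonzero multiple of the sum over \<open>A\<close>, and the
  product of its \<open>N\<close> coordinate copies is a nonzero multiple of the sum over \<open>A\<^sup>N\<close>. Thus every
  function \<open>A\<^sup>N \<rightarrow> GF(p)\<close> of degree less than \<open>d N\<close> sums to zero. Degrees are submultiplicative under
  composition and subadditive under products, so the indicator function of the zero set, the
  product of the \<open>\<delta>\<^sub>0 \<circ> f\<^sub>i\<close>, has degree at most \<open>d (\<Sum>i. Fdeg f\<^sub>i) < d N\<close>; its sum is the number of
  zeros. Functions to \<open>GF(p)\<close> are represented by integer functions modulo \<open>p\<close>.\<close>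

section \<open>Iterated differences\<close>

fun iter_diff :: "'a list \<Rightarrow> ('a::ab_group_add \<Rightarrow> 'b::ab_group_add) \<Rightarrow> 'a \<Rightarrow> 'b" where
  "iter_diff [] f = f"
| "iter_diff (a # as) f = (\<lambda>x. iter_diff as f (x + a) - iter_diff as f x)"

lemma iter_diff_append: "iter_diff (as @ bs) f = iter_diff as (iter_diff bs f)"
  by (induction as) auto

lemma iter_diff_snoc: "iter_diff (as @ [a]) f = iter_diff as (\<lambda>x. f (x + a) - f x)"
  by (simp add: iter_diff_append)

lemma iter_diff_additive:
  assumes "\<And>u v. h (u - v) = h u - h v"
  shows "iter_diff as (\<lambda>x. h (f x)) = (\<lambda>x. h (iter_diff as f x))"
  by (induction as) (auto simp: assms)

lemma iter_diff_add: "iter_diff as (\<lambda>x. f x + g x) = (\<lambda>x. iter_diff as f x + iter_diff as g x)"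
  by (induction as) auto

lemma iter_diff_sum: "iter_diff as (\<lambda>x. \<Sum>i\<in>I. f i x) = (\<lambda>x. \<Sum>i\<in>I. iter_diff as (f i) x)"
  by (induction as) (auto simp: sum_subtractf)

lemma iter_diff_mult_left: "iter_diff as (\<lambda>x. c * f x) = (\<lambda>x. c * iter_diff as f x)" for c :: "'b::ring"
  by (rule iter_diff_additive) (simp add: algebra_simps)

lemma iter_diff_translate: "iter_diff as (\<lambda>x. f (x + b)) = (\<lambda>x. iter_diff as f (x + b))"
  by (induction as) (auto simp: algebra_simps)

lemma iter_diff_const: "as \<noteq> [] \<Longrightarrow> iter_diff as (\<lambda>_. c) = (\<lambda>_. 0)"
  by (induction as rule: induct_list012) auto

section \<open>The action of the group ring on functions\<close>

lemma int_mult_0 [simp]: "int_mult 0 b = 0"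
  by (simp add: int_mult_def)

lemma int_mult_1 [simp]: "int_mult 1 b = b"
  by (simp add: int_mult_def)

lemma int_mult_add_1: "int_mult (z + 1) b = int_mult z b + b"
proof (cases "z \<ge> 0")
  case True
  then have "nat (z + 1) = Suc (nat z)" by simp
  with True show ?thesis by (simp add: int_mult_def add.commute)
next
  case False
  then have "nat (- z) = Suc (nat (- (z + 1)))" by simp
  with False show ?thesis by (cases "z = -1") (simp_all add: int_mult_def)
qed

lemma act_eq_sum:
  assumes "finite S" "Poly_Mapping.keys z \<subseteq> S"
  shows "act z f x = (\<Sum>a\<in>S. int_mult (Poly_Mapping.lookup z a) (f (x + a)))"
  unfolding act_def using assms
  by (intro sum.mono_neutral_left) (auto simp: in_keys_iff)

lemma act_0 [simp]: "act 0 f x = 0"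
  by (simp add: act_def)

lemma act_add_tau: "act (z + tau b) f x = act z f x + f (x + b)"
proof -
  let ?S = "insert b (Poly_Mapping.keys z)"
  have "act (z + tau b) f x =
      (\<Sum>a\<in>?S. int_mult (Poly_Mapping.lookup (z + tau b) a) (f (x + a)))"
    by (rule act_eq_sum) (use keys_add[of z "tau b"] in auto)
  also have "\<dots> = (\<Sum>a\<in>?S. int_mult (Poly_Mapping.lookup z a) (f (x + a)) +
      (if a = b then f (x + b) else 0))"
    by (intro sum.cong) (auto simp: lookup_add lookup_single int_mult_add_1)
  also have "\<dots> = act z f x + f (x + b)"
    by (subst sum.distrib, subst act_eq_sum[of ?S]) auto
  finally show ?thesis .
qed

lemma act_diff_tau: "act (z - tau b) f x = act z f x - f (x + b)"
  using act_add_tau[of "z - tau b" b f x] by simp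

lemma act_tau [simp]: "act (tau b) f x = f (x + b)"
  using act_add_tau[of 0 b f x] by simp

text \<open>The \<open>tau b\<close> generate the group ring additively, so identities for
  \<open>act\<close> can be checked one translation at a time, without inspecting
  coefficients.\<close>

lemma group_ring_induct [case_names zero add diff]:
  fixes z :: "'a::ab_group_add group_ring"
  assumes "P 0" "\<And>z b. P z \<Longrightarrow> P (z + tau b)" "\<And>z b. P z \<Longrightarrow> P (z - tau b)"
  shows "P z"
proof -
  \<comment> \<open>\<open>frag_induction\<close> passes to differences of arbitrary elements; the
    offset \<open>w\<close> and both signs make the claim stable under that.\<close>
  have "\<forall>w. P w \<longrightarrow> P (w + z) \<and> P (w - z)"
  proof (rule frag_induction[of z UNIV])
    fix u v :: "'a group_ring"
    assume "\<forall>w. P w \<longrightarrow> P (w + u) \<and> P (w - u)" "\<forall>w. P w \<longrightarrow> P (w + v) \<and> P (w - v)"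
    then show "\<forall>w. P w \<longrightarrow> P (w + (u - v)) \<and> P (w - (u - v))"
      by (metis add_diff_eq diff_diff_eq2 diff_add_eq)
  qed (auto simp: assms)
  with assms(1) show ?thesis by (metis add_0)
qed

lemma act_add: "act (z + w) f x = act z f x + act w f x"
proof (induction w rule: group_ring_induct)
  case zero show ?case by simp
next
  case (add w b)
  then show ?case
    using act_add_tau[of "z + w" b f x] by (simp add: act_add_tau add.assoc)
next
  case (diff w b)
  then show ?case
    using act_diff_tau[of "z + w" b f x] by (simp add: act_diff_tau add_diff_eq)
qed

lemma act_diff: "act (z - w) f x = act z f x - act w f x"
  using act_add[of "z - w" w f x] by simp

lemma act_tau_mult: "act (tau b * w) f x = act w f (x + b)"
proof (induction w rule: group_ring_induct)
  case zero show ?case by simp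
next
  case (add w c)
  then show ?case
    by (simp add: distrib_left mult_single act_add add.assoc)
next
  case (diff w c)
  then show ?case
    by (simp add: right_diff_distrib mult_single act_diff add.assoc)
qed

lemma act_mult: "act (z * w) f x = act z (act w f) x"
  by (induction z rule: group_ring_induct)
    (simp_all add: distrib_right left_diff_distrib act_add act_diff act_tau_mult)

text \<open>Each factor \<open>tau a - 1\<close> acts as the difference in direction
  \<open>a\<close>; this links the group ring to \<open>iter_diff\<close>.\<close>

lemma act_aug_prod: "act (\<Prod>a\<leftarrow>as. tau a - 1) f = iter_diff as f"
proof (induction as)
  case Nil
  show ?case using act_tau[of 0 f] by auto
next
  case (Cons a as)
  have "act 1 g x = g x" for g :: "'a \<Rightarrow> 'b" and x
    using act_tau[of 0 g x] by simp
  with Cons show ?case by (auto simp: act_mult act_diff)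
qed

lemma iter_diff_act: "iter_diff as (act z f) = act z (iter_diff as f)"
proof -
  have "iter_diff as (act z f) x = act z (iter_diff as f) x" for x
    unfolding act_aug_prod[symmetric] act_mult[symmetric] by (simp only: mult.commute)
  then show ?thesis by blast
qed

lemma act_of_nat_mult:
  fixes f :: "'a::ab_group_add \<Rightarrow> int"
  shows "act (of_nat n * z) f x = int n * act z f x"
  by (induction n) (simp_all add: distrib_right act_add)

section \<open>From functional degree to vanishing differences\<close>

lemma aug_prod_in_ideal_power:
  "(\<Prod>a\<leftarrow>as. tau a - 1) \<in> ideal_power Aug (length as)"
proof (cases "as = []")
  case False
  interpret module "(*) :: 'a group_ring \<Rightarrow> 'a group_ring \<Rightarrow> 'a group_ring"
    by unfold_locales (simp_all add: algebra_simps)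
  have "(\<Prod>a\<leftarrow>as. tau a - 1) = (\<Prod>k<length as. tau (as ! k) - 1)"
    by (subst prod.list_conv_set_nth) (auto simp: atLeast0LessThan)
  moreover have "tau a - 1 \<in> Aug" for a :: 'a
    unfolding Aug_def ideal_generated_def by (auto intro: span_base)
  ultimately show ?thesis
    using False unfolding ideal_power_def ideal_generated_def
    by (auto intro!: span_base)
qed (simp add: ideal_power_def)

lemma Fdeg_imp_iter_diff_eq_0:
  assumes "Fdeg f = enat m" "length as = Suc m"
  shows "iter_diff as f = (\<lambda>_. 0)"
proof -
  from assms have ex: "\<exists>n. annihilates (ideal_power Aug (n + 1)) f"
    and m: "m = (LEAST n. annihilates (ideal_power Aug (n + 1)) f)"
    by (auto simp: Fdeg_def split: if_splits)
  from LeastI_ex[OF ex] have "annihilates (ideal_power Aug (m + 1)) f"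
    by (simp add: m)
  with aug_prod_in_ideal_power[of as] assms(2) show ?thesis
    by (simp add: annihilates_def flip: act_aug_prod)
qed

section \<open>The Leibniz rule and degrees modulo \<open>p\<close>\<close>

text \<open>Leibniz rule for a descending multiplicative filtration \<open>J\<close>: when
  \<open>i\<close> differences fall on \<open>\<phi>\<close> and \<open>j\<close> on
  \<open>\<psi>\<close>, the product reaches level \<open>w i + v j\<close>. The abstract form
  serves both degrees modulo \<open>p\<close> and the augmentation filtration.\<close>

lemma iter_diff_mult_mem:
  fixes \<phi> \<psi> :: "'a::ab_group_add \<Rightarrow> 'r::ring"
  assumes add: "\<And>k u v. u \<in> J k \<Longrightarrow> v \<in> J k \<Longrightarrow> u + v \<in> J k"
    and mult: "\<And>i j u v. u \<in> J i \<Longrightarrow> v \<in> J j \<Longrightarrow> u * v \<in> J (i + j)"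
    and anti: "\<And>i j. i \<le> j \<Longrightarrow> J j \<subseteq> J i"
    and "\<And>bs x. length bs \<le> n \<Longrightarrow> iter_diff bs \<phi> x \<in> J (w (length bs))"
    and "\<And>bs x. length bs \<le> n \<Longrightarrow> iter_diff bs \<psi> x \<in> J (v (length bs))"
    and "\<And>i j. i + j = n \<Longrightarrow> k \<le> w i + v j"
    and "length as = n"
  shows "iter_diff as (\<lambda>x. \<phi> x * \<psi> x) x \<in> J (k :: nat)"
  using assms(4-)
proof (induction n arbitrary: \<phi> \<psi> w v as x)
  case 0
  from "0.prems"(1)[of "[]"] "0.prems"(2)[of "[]"]
  have "\<phi> x * \<psi> x \<in> J (w 0 + v 0)" by (simp add: mult)
  with anti[of k "w 0 + v 0"] 0 show ?case by auto
next
  case (Suc n)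
  obtain bs a where as: "as = bs @ [a]" and bs: "length bs = n"
    using Suc.prems(4) by (cases as rule: rev_cases) auto
  have "iter_diff bs (\<lambda>x. (\<phi> (x + a) - \<phi> x) * \<psi> (x + a)) x \<in> J k"
  proof (rule Suc.IH[of _ "\<lambda>i. w (Suc i)" _ v])
    show "iter_diff cs (\<lambda>x. \<phi> (x + a) - \<phi> x) y \<in> J (w (Suc (length cs)))"
      if "length cs \<le> n" for cs y
      using Suc.prems(1)[of "cs @ [a]"] that by (simp add: iter_diff_snoc)
    show "iter_diff cs (\<lambda>x. \<psi> (x + a)) y \<in> J (v (length cs))" if "length cs \<le> n" for cs y
      using Suc.prems(2)[of cs] that by (simp add: iter_diff_translate)
    show "k \<le> w (Suc i) + v j" if "i + j = n" for i j
      using Suc.prems(3)[of "Suc i" j] that by simp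
  qed (rule bs)
  moreover have "iter_diff bs (\<lambda>x. \<phi> x * (\<psi> (x + a) - \<psi> x)) x \<in> J k"
  proof (rule Suc.IH[of _ w _ "\<lambda>i. v (Suc i)"])
    show "iter_diff cs (\<lambda>x. \<psi> (x + a) - \<psi> x) y \<in> J (v (Suc (length cs)))"
      if "length cs \<le> n" for cs y
      using Suc.prems(2)[of "cs @ [a]"] that by (simp add: iter_diff_snoc)
    show "iter_diff cs \<phi> y \<in> J (w (length cs))" if "length cs \<le> n" for cs y
      using Suc.prems(1)[of cs] that by simp
    show "k \<le> w i + v (Suc j)" if "i + j = n" for i j
      using Suc.prems(3)[of i "Suc j"] that by simp
  qed (rule bs)
  moreover have "iter_diff as (\<lambda>x. \<phi> x * \<psi> x) x =
      iter_diff bs (\<lambda>x. (\<phi> (x + a) - \<phi> x) * \<psi> (x + a) + \<phi> x * (\<psi> (x + a) - \<psi> x)) x"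
    by (simp add: as iter_diff_snoc algebra_simps)
  ultimately show ?case
    by (simp add: iter_diff_add add)
qed

text \<open>The bound is strict so that \<open>n = 0\<close> expresses vanishing modulo
  \<open>p\<close>.\<close>

definition deg_less_mod :: "int \<Rightarrow> nat \<Rightarrow> ('a::ab_group_add \<Rightarrow> int) \<Rightarrow> bool"
  where "deg_less_mod p n g \<longleftrightarrow> (\<forall>as x. length as = n \<longrightarrow> p dvd iter_diff as g x)"

lemma deg_less_mod_mono:
  assumes "deg_less_mod p m g" "m \<le> n"
  shows "deg_less_mod p n g"
  unfolding deg_less_mod_def
proof (intro allI impI)
  fix as :: "'a list" and x
  assume "length as = n"
  define bs cs where "bs = take (n - m) as" and "cs = drop (n - m) as"
  have "length cs = m" using \<open>length as = n\<close> assms(2) by (simp add: cs_def)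
  have "p dvd iter_diff bs (iter_diff cs g) x"
  proof (induction bs arbitrary: x)
    case Nil
    show ?case using assms(1) \<open>length cs = m\<close> by (simp add: deg_less_mod_def)
  qed simp
  then show "p dvd iter_diff as g x"
    by (simp add: bs_def cs_def flip: iter_diff_append)
qed

lemma deg_less_mod_mult:
  assumes "deg_less_mod p (Suc i) \<phi>" "deg_less_mod p (Suc j) \<psi>"
  shows "deg_less_mod p (Suc (i + j)) (\<lambda>x. \<phi> x * \<psi> x)"
proof -
  \<comment> \<open>Level \<open>0\<close> is all integers, every higher level the multiples of
    \<open>p\<close>. The weight \<open>w i n\<close> becomes \<open>1\<close> once \<open>n\<close>
    exceeds \<open>i\<close>; among \<open>i + j + 1\<close> differences this happens for one of the
    factors.\<close>
  define J :: "nat \<Rightarrow> int set" where "J k = (if k = 0 then UNIV else {z. p dvd z})" for k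
  define w where "w i n = (if i < n then 1 else 0 :: nat)" for i n :: nat
  have *: "iter_diff bs g x \<in> J (w i (length bs))" if "deg_less_mod p (Suc i) g"
    for i g and bs :: "'a list" and x
    using deg_less_mod_mono[OF that, of "length bs"] by (auto simp: J_def w_def deg_less_mod_def)
  have "iter_diff as (\<lambda>x. \<phi> x * \<psi> x) x \<in> J 1" if "length as = Suc (i + j)" for as x
    by (rule iter_diff_mult_mem[where J = J and n = "Suc (i + j)" and w = "w i" and v = "w j"])
      (use * assms that in \<open>auto simp: J_def w_def split: if_splits\<close>)
  then show ?thesis by (simp add: deg_less_mod_def J_def)
qed

lemma deg_less_mod_prod:
  assumes "finite I" "\<And>i. i \<in> I \<Longrightarrow> deg_less_mod p (Suc (m i)) (g i)"
  shows "deg_less_mod p (Suc (\<Sum>i\<in>I. m i)) (\<lambda>x. \<Prod>i\<in>I. g i x)"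
  using assms
proof (induction I rule: finite_induct)
  case empty
  show ?case by (auto simp: deg_less_mod_def iter_diff_const simp flip: length_0_conv)
next
  case (insert i I)
  then show ?case by (auto intro: deg_less_mod_mult)
qed

section \<open>The degree of a composition\<close>

text \<open>Modulo \<open>p\<close>, the \<open>k\<close>-th power of the augmentation ideal, replaced by the annihilator of the
  functions of degree less than \<open>k\<close>, which contains it.\<close>

definition aug_filtration :: "int \<Rightarrow> nat \<Rightarrow> 'a::ab_group_add group_ring set"
  where "aug_filtration p k = {z. \<forall>g. deg_less_mod p k g \<longrightarrow> p dvd act z g 0}"

lemma act_translate: "act z (\<lambda>x. g (x + b)) = (\<lambda>x. act z g (x + b))"
  by (auto simp: act_def algebra_simps)

text \<open>Translating \<open>g\<close> preserves its degree bound, so the test at the point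
  \<open>0\<close> controls every point.\<close>

lemma aug_filtrationD:
  assumes "z \<in> aug_filtration p k" "deg_less_mod p k g"
  shows "p dvd act z g x"
proof -
  have "deg_less_mod p k (\<lambda>y. g (y + x))"
    using assms(2) by (simp add: deg_less_mod_def iter_diff_translate)
  with assms(1) have "p dvd act z (\<lambda>y. g (y + x)) 0"
    by (auto simp: aug_filtration_def)
  then show ?thesis by (simp add: act_translate)
qed

lemma aug_filtration_0: "aug_filtration p 0 = UNIV"
proof -
  have "p dvd act z g 0" if "deg_less_mod p 0 g" for z :: "'a group_ring" and g
    using that
    by (induction z rule: group_ring_induct) (auto simp: act_add act_diff deg_less_mod_def)
  then show ?thesis by (auto simp: aug_filtration_def)
qed

lemma aug_filtration_antimono: "i \<le> j \<Longrightarrow> aug_filtration p j \<subseteq> aug_filtration p i"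
  by (auto simp: aug_filtration_def intro: deg_less_mod_mono)

lemma aug_filtration_add:
  "u \<in> aug_filtration p k \<Longrightarrow> v \<in> aug_filtration p k \<Longrightarrow> u + v \<in> aug_filtration p k"
  by (auto simp: aug_filtration_def act_add)

text \<open>Acting by \<open>v\<close> commutes with differences and so lowers the degree modulo
  \<open>p\<close> by \<open>j\<close>; \<open>u\<close> then meets a function of degree less than
  \<open>i\<close>.\<close>

lemma aug_filtration_mult:
  assumes "u \<in> aug_filtration p i" "v \<in> aug_filtration p j"
  shows "u * v \<in> aug_filtration p (i + j)"
proof -
  have "p dvd act (u * v) g 0" if "deg_less_mod p (i + j) g" for g
  proof -
    have "p dvd iter_diff as (act v g) x" if "length as = i" for as x
    proof -
      have "deg_less_mod p j (iter_diff as g)"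
        unfolding deg_less_mod_def using \<open>deg_less_mod p (i + j) g\<close> that
        by (auto simp: deg_less_mod_def simp flip: iter_diff_append)
      then show ?thesis
        using aug_filtrationD[OF assms(2)] by (simp add: iter_diff_act)
    qed
    then have "deg_less_mod p i (act v g)" by (simp add: deg_less_mod_def)
    with aug_filtrationD[OF assms(1)] show ?thesis by (simp add: act_mult)
  qed
  then show ?thesis by (simp add: aug_filtration_def)
qed

lemma tau_diff_1_in_aug_filtration: "tau a - 1 \<in> aug_filtration p 1"
proof -
  have "p dvd act (tau a - 1) g 0" if "deg_less_mod p 1 g" for g
  proof -
    from that have "p dvd iter_diff [a] g 0"
      unfolding deg_less_mod_def by (metis One_nat_def length_Cons list.size(3))
    then show ?thesis using act_tau[of 0 g 0] by (simp add: act_diff)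
  qed
  then show ?thesis by (simp add: aug_filtration_def)
qed

text \<open>If \<open>f\<close> has degree at most \<open>m\<close>, then the \<open>n\<close>-fold differences of \<open>\<tau>\<^bsub>f x\<^esub>\<close> lie in step \<open>\<lceil>n / m\<rceil>\<close> of
  the filtration. The induction on \<open>m\<close> rests on the Leibniz rule for
  \<open>\<tau>\<^bsub>f (x + a)\<^esub> - \<tau>\<^bsub>f x\<^esub> = \<tau>\<^bsub>f x\<^esub> (\<tau>\<^bsub>h x\<^esub> - 1)\<close>, where \<open>h x = f (x + a) - f x\<close> has degree at most \<open>m - 1\<close>.\<close>

lemma iter_diff_tau_comp_mem:
  fixes f :: "'a::ab_group_add \<Rightarrow> 'b::ab_group_add"
  assumes "\<And>as x. length as = Suc m \<Longrightarrow> iter_diff as f x = 0" "m * k < length as"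
  shows "iter_diff as (\<lambda>x. tau (f x)) x \<in> aug_filtration p (Suc k)"
  using assms
proof (induction m arbitrary: f as k x)
  case 0
  have "f y = f 0" for y
    using "0.prems"(1)[of "[y]" 0] by simp
  then have "(\<lambda>x. tau (f x)) = (\<lambda>_. tau (f 0))" by metis
  then have "iter_diff as (\<lambda>x. tau (f x)) = (\<lambda>_. 0)"
    using "0.prems"(2) iter_diff_const[of as "tau (f 0)"] by auto
  then show ?case by (simp add: aug_filtration_def)
next
  case (Suc m)
  \<comment> \<open>The level is the ceiling of \<open>length as / Suc m\<close>. The induction is
    on the length because the Leibniz rule leads back to \<open>tau (f x)\<close> with fewer
    differences.\<close>
  have main: "iter_diff as (\<lambda>x. tau (f x)) x \<in> aug_filtration p ((length as + m) div Suc m)"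
    for as x
  proof (induction "length as" arbitrary: as x rule: less_induct)
    case less
    show ?case
    proof (cases as rule: rev_cases)
      case Nil
      then show ?thesis by (simp add: aug_filtration_0)
    next
      case (snoc bs a)
      define h where "h = (\<lambda>x. f (x + a) - f x)"
      have h: "iter_diff cs h y = 0" if "length cs = Suc m" for cs y
        using Suc.prems(1)[of "cs @ [a]"] that by (simp add: h_def iter_diff_snoc)
      have "iter_diff bs (\<lambda>x. tau (f x) * (tau (h x) - 1)) x
          \<in> aug_filtration p ((length as + m) div Suc m)"
      \<comment> \<open>The weight \<open>w\<close> comes from the induction on the length,
        \<open>v\<close> from the induction on \<open>m\<close> applied to \<open>h\<close>. The
        \<open>Suc\<close> in \<open>v\<close> reflects that \<open>tau (h x) - 1\<close> has level
        \<open>1\<close> before any difference is taken.\<close>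
      proof (rule iter_diff_mult_mem[where n = "length bs" and J = "aug_filtration p" and
            \<phi> = "\<lambda>x. tau (f x)" and \<psi> = "\<lambda>x. tau (h x) - 1" and
            w = "\<lambda>i. (i + m) div Suc m" and v = "\<lambda>j. Suc (j div Suc m)"])
        show "iter_diff cs (\<lambda>x. tau (f x)) y \<in> aug_filtration p ((length cs + m) div Suc m)"
          if "length cs \<le> length bs" for cs y
          using less that snoc by simp
        show "iter_diff cs (\<lambda>x. tau (h x) - 1) y \<in> aug_filtration p (Suc (length cs div Suc m))"
          for cs y
        proof (cases "cs = []")
          case True
          then show ?thesis using tau_diff_1_in_aug_filtration by simp
        next
          case False
          let ?k = "length cs div Suc m"
          have "Suc m * ?k \<le> length cs" by (rule times_div_less_eq_dividend)
          with False have "m * ?k < length cs"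
            by (cases "?k = 0") auto
          from Suc.IH[OF h this]
          have "iter_diff cs (\<lambda>x. tau (h x)) y \<in> aug_filtration p (Suc ?k)" .
          moreover have "iter_diff cs (\<lambda>x. tau (h x) - 1) = iter_diff cs (\<lambda>x. tau (h x))"
            using iter_diff_add[of cs "\<lambda>x. tau (h x)" "\<lambda>_. -1"] iter_diff_const[OF False, of "-1 :: 'b group_ring"]
            by simp
          ultimately show ?thesis by simp
        qed
        show "(length as + m) div Suc m \<le> (i + m) div Suc m + Suc (j div Suc m)"
          if "i + j = length bs" for i j
        proof -
          \<comment> \<open>\<open>as\<close> has one direction more than \<open>bs\<close>, which
            turns the ceiling into one plus a floor.\<close>
          have "length as + m = Suc m + (i + j)" using snoc that by simp
          then have "(length as + m) div Suc m = Suc ((i + j) div Suc m)"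
            using div_add_self1[of "Suc m" "i + j"] by (simp only:)
          moreover have "(i + j) div Suc m \<le> (i + m) div Suc m + j div Suc m"
          proof -
            have "i + j \<le> i + (Suc m * (j div Suc m) + m)"
              using mult_div_mod_eq[of "Suc m" j] mod_less_divisor[of "Suc m" j] by linarith
            then have "(i + j) div Suc m \<le> ((i + m) + Suc m * (j div Suc m)) div Suc m"
              by (intro div_le_mono) linarith
            then show ?thesis by (simp del: mult_Suc)
          qed
          ultimately show ?thesis by simp
        qed
      qed (auto intro: aug_filtration_add aug_filtration_mult
          dest: aug_filtration_antimono[THEN subsetD])
      moreover have "(\<lambda>x. tau (f (x + a)) - tau (f x)) = (\<lambda>x. tau (f x) * (tau (h x) - 1))"
        by (simp add: h_def right_diff_distrib mult_single)
      ultimately show ?thesis by (simp add: snoc iter_diff_snoc)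
    qed
  qed
  have "Suc k \<le> (length as + m) div Suc m"
  proof -
    have "Suc m * Suc k \<le> length as + m" using Suc.prems(2) by simp
    then show ?thesis by (simp add: less_eq_div_iff_mult_less_eq mult.commute del: mult_Suc mult_Suc_right)
  qed
  with main aug_filtration_antimono show ?case by blast
qed

text \<open>Since \<open>g (f x)\<close> is the action of \<open>tau (f x)\<close> on
  \<open>g\<close> at \<open>0\<close>, differences in \<open>x\<close> can be taken inside the
  group ring, where order \<open>m * d + 1\<close> reaches level \<open>d + 1\<close> of the
  filtration.\<close>

lemma deg_less_mod_comp:
  fixes f :: "'a::ab_group_add \<Rightarrow> 'b::ab_group_add"
  assumes "\<And>as x. length as = Suc m \<Longrightarrow> iter_diff as f x = 0" "deg_less_mod p (Suc d) g"
  shows "deg_less_mod p (Suc (m * d)) (\<lambda>x. g (f x))"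
  unfolding deg_less_mod_def
proof (intro allI impI)
  fix as :: "'a list" and x assume len: "length as = Suc (m * d)"
  have "iter_diff as (\<lambda>x. act (tau (f x)) g 0) = (\<lambda>x. act (iter_diff as (\<lambda>x. tau (f x)) x) g 0)"
    by (rule iter_diff_additive) (rule act_diff)
  moreover have "iter_diff as (\<lambda>x. tau (f x)) x \<in> aug_filtration p (Suc d)"
    by (rule iter_diff_tau_comp_mem[OF assms(1)]) (use len in auto)
  ultimately show "p dvd iter_diff as (\<lambda>x. g (f x)) x"
    using aug_filtrationD[OF _ assms(2)] by simp
qed

section \<open>Nilpotency of the augmentation ideal modulo \<open>p\<close>\<close>

lemma dvd_power_diff: "x - y dvd x ^ n - y ^ n" for x y :: "'r::comm_ring_1"
  by (cases n) (simp_all add: diff_power_eq_sum del: power_Suc)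

lemma prime_dvd_add_power_diff:
  fixes y :: "'r::comm_ring_1"
  assumes "prime p"
  shows "of_nat p dvd (y + 1) ^ p - (y ^ p + 1)"
proof -
  have p: "p > 0" using assms prime_gt_0_nat by blast
  have "{..p} = insert 0 (insert p {0<..<p})" using p by auto
  then have "(y + 1) ^ p - (y ^ p + 1) = (\<Sum>k\<in>{0<..<p}. of_nat (p choose k) * y ^ k)"
    using p by (simp add: binomial_ring)
  also have "of_nat p dvd \<dots>"
  proof (intro dvd_sum dvd_mult2)
    fix k assume "k \<in> {0<..<p}"
    then have "p dvd p choose k" by (intro dvd_choose_prime) (use assms p in auto)
    then show "(of_nat p :: 'r) dvd of_nat (p choose k)" by (auto elim!: dvdE)
  qed
  finally show ?thesis .
qed

lemma prime_dvd_add_power_power_diff: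
  fixes y :: "'r::comm_ring_1"
  assumes "prime p"
  shows "of_nat p dvd (y + 1) ^ (p ^ k) - (y ^ (p ^ k) + 1)"
proof (induction k)
  case (Suc k)
  let ?u = "(y + 1) ^ (p ^ k)" and ?v = "y ^ (p ^ k)"
  have "of_nat p dvd (?u ^ p - (?v + 1) ^ p) + ((?v + 1) ^ p - (?v ^ p + 1))"
    by (intro dvd_add prime_dvd_add_power_diff assms dvd_trans[OF Suc dvd_power_diff])
  moreover have "x ^ (p ^ Suc k) = (x ^ (p ^ k)) ^ p" for x :: 'r
    by (simp add: mult.commute flip: power_mult)
  ultimately show ?case by (simp only: add_diff_eq diff_add_cancel)
qed simp

text \<open>Translation by \<open>a\<close> permutes the group; comparing the sums of all
  \<open>x\<close> and all \<open>x + a\<close> shows that \<open>CARD('a)\<close> copies of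
  \<open>a\<close> add up to \<open>0\<close>.\<close>

lemma tau_power_card:
  fixes a :: "'a::{finite,ab_group_add}"
  shows "tau a ^ CARD('a) = 1"
proof -
  have "tau a ^ card S = tau (\<Sum>x\<in>S. a)" if "finite S" for S :: "'a set"
    using that by (induction S rule: finite_induct) (simp_all add: mult_single)
  moreover have "(\<Sum>x\<in>(UNIV::'a set). a) = 0"
  proof -
    have "(\<Sum>x\<in>(UNIV::'a set). x) = (\<Sum>x\<in>UNIV. x + a)"
      by (rule sum.reindex_bij_witness[of _ "\<lambda>x. x + a" "\<lambda>x. x - a"]) auto
    then show ?thesis by (simp add: sum.distrib)
  qed
  ultimately show ?thesis by simp
qed

lemma prime_dvd_aug_power_card:
  fixes a :: "'a::{finite,ab_group_add}"
  assumes "prime p" "CARD('a) = p ^ k"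
  shows "of_nat p dvd (tau a - 1) ^ CARD('a)"
proof -
  \<comment> \<open>For \<open>y = tau a - 1\<close> the power of \<open>y + 1\<close> is
    \<open>1\<close>, so the Frobenius congruence leaves \<open>- (y ^ CARD('a))\<close>.\<close>
  have "of_nat p dvd - ((tau a - 1) ^ CARD('a))"
    using prime_dvd_add_power_power_diff[OF assms(1), of "tau a - 1" k] tau_power_card[of a]
    by (simp add: assms(2))
  then show ?thesis by simp
qed

lemma aug_prod_eq_prod_count:
  fixes as :: "'a::{finite,ab_group_add} list"
  shows "(\<Prod>a\<leftarrow>as. tau a - 1) = (\<Prod>a\<in>UNIV. (tau a - 1) ^ count_list as a)"
proof (induction as)
  case (Cons b as)
  have "(\<Prod>a\<in>UNIV. (tau a - 1) ^ count_list (b # as) a) =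
      (\<Prod>a\<in>UNIV. (if a = b then tau a - 1 else 1) * (tau a - 1) ^ count_list as a)"
    by (intro prod.cong) auto
  also have "\<dots> = (tau b - 1) * (\<Prod>a\<in>UNIV. (tau a - 1) ^ count_list as a)"
    by (subst prod.distrib) simp
  finally show ?case by (simp add: Cons)
qed simp

text \<open>By pigeonhole, among \<open>?q * ?q\<close> directions some \<open>a\<close> occurs at
  least \<open>?q\<close> times, and \<open>(tau a - 1) ^ ?q\<close> vanishes modulo
  \<open>p\<close>.\<close>

lemma exists_deg_less_mod_all:
  assumes "prime p" "CARD('a::{finite,ab_group_add}) = p ^ k"
  shows "\<exists>n. \<forall>g :: 'a::{finite,ab_group_add} \<Rightarrow> int. deg_less_mod (int p) n g"
proof (intro exI allI)
  fix g :: "'a \<Rightarrow> int"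
  let ?q = "CARD('a)"
  have "int p dvd iter_diff as g x" if len: "length as = ?q * ?q" for as x
  proof -
    have "\<exists>a. ?q \<le> count_list as a"
    proof (rule ccontr)
      assume "\<not> ?thesis"
      then have "(\<Sum>a\<in>UNIV. count_list as a) < (\<Sum>a\<in>(UNIV::'a set). ?q)"
        by (intro sum_strict_mono) (auto simp: not_le)
      moreover have "(\<Sum>a\<in>UNIV. count_list as a) = length as"
        by (intro sum_count_set) auto
      ultimately show False using len by simp
    qed
    then obtain a where "?q \<le> count_list as a" ..
    then have "of_nat p dvd (tau a - 1) ^ count_list as a"
      using prime_dvd_aug_power_card[OF assms] le_imp_power_dvd dvd_trans by blast
    also have "\<dots> dvd (\<Prod>a\<leftarrow>as. tau a - 1)"
      unfolding aug_prod_eq_prod_count by (rule dvd_prodI) auto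
    finally obtain z where "(\<Prod>a\<leftarrow>as. tau a - 1) = of_nat p * z" ..
    then have "iter_diff as g x = int p * act z g x"
      by (simp add: act_of_nat_mult flip: act_aug_prod)
    then show ?thesis by simp
  qed
  then show "deg_less_mod (int p) (?q * ?q) g" by (simp add: deg_less_mod_def)
qed

section \<open>Summation over the group as an iterated difference\<close>

text \<open>\<open>Suc d\<close> is the largest degree modulo \<open>p\<close> on the group, so it
  plays the role of \<open>d\<close> in the overview. Differences of that order are constant modulo
  \<open>p\<close>, and a nonzero one is a multiple of summation.\<close>

lemma exists_iter_diff_cong_sum:
  assumes "prime p" "CARD('a::{finite,ab_group_add}) = p ^ k" "CARD('a) > 1"
  obtains as :: "'a::{finite,ab_group_add} list" and c d where
    "length as = Suc d" "\<not> int p dvd c" "\<And>g :: 'a::{finite,ab_group_add} \<Rightarrow> int. deg_less_mod (int p) (Suc (Suc d)) g"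
    "\<And>g x. [iter_diff as g x = c * (\<Sum>y\<in>UNIV. g y)] (mod int p)"
proof -
  define \<delta> :: "'a \<Rightarrow> int" where "\<delta> x = (if x = 0 then 1 else 0)" for x
  let ?P = "\<lambda>n. \<forall>g :: 'a \<Rightarrow> int. deg_less_mod (int p) n g"
  \<comment> \<open>Nontriviality of the group makes the largest degree positive; the strict
    inequality of the theorem is later scaled by it.\<close>
  have not1: "\<not> ?P 1"
  proof
    assume "?P 1"
    obtain a :: 'a where "a \<noteq> 0"
      using assms(3) by (metis (full_types) UNIV_eq_I card.empty card_insert_if finite.emptyI
          insertCI less_irrefl One_nat_def empty_iff)
    from \<open>?P 1\<close> have "int p dvd iter_diff [a] \<delta> 0"
      unfolding deg_less_mod_def by (metis One_nat_def length_Cons list.size(3))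
    with \<open>a \<noteq> 0\<close> assms(1) show False
      by (simp add: \<delta>_def not_prime_unit)
  qed
  define D where "D = (LEAST n. ?P n)"
  have D: "?P D"
    unfolding D_def by (rule LeastI_ex) (rule exists_deg_less_mod_all[OF assms(1,2)])
  have "D > 1"
    using deg_less_mod_mono D not1 by (metis not_le)
  define d where "d = D - 2"
  have d: "D = Suc (Suc d)" using \<open>D > 1\<close> unfolding d_def by linarith
  have "\<not> ?P (Suc d)"
    using not_less_Least[of "Suc d" ?P] d by (simp add: D_def)
  then obtain as :: "'a list" and g0 x0
    where as: "length as = Suc d" and nz: "\<not> int p dvd iter_diff as g0 x0"
    by (auto simp: deg_less_mod_def)
  define c where "c = iter_diff as \<delta> 0"
  have const: "[iter_diff as \<delta> x = c] (mod int p)" for x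
  proof -
    \<comment> \<open>One further difference, in direction \<open>x\<close>, has order
      \<open>D\<close> and vanishes modulo \<open>p\<close>.\<close>
    have "int p dvd iter_diff (x # as) \<delta> 0"
      using D as d unfolding deg_less_mod_def by (metis length_Cons)
    then show ?thesis by (simp add: c_def cong_iff_dvd_diff)
  qed
  have cong: "[iter_diff as g x = c * (\<Sum>y\<in>UNIV. g y)] (mod int p)" for g x
  proof -
    \<comment> \<open>Every \<open>g\<close> is a combination of translates of
      \<open>\<delta>\<close>, so \<open>c\<close> determines its differences along
      \<open>as\<close>.\<close>
    have "g = (\<lambda>x. \<Sum>y\<in>UNIV. g y * \<delta> (x + (- y)))"
      by (auto simp: \<delta>_def if_distrib cong: if_cong)
    then have "iter_diff as g x = (\<Sum>y\<in>UNIV. g y * iter_diff as \<delta> (x + (- y)))"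
      using iter_diff_sum[of as "\<lambda>y x. g y * \<delta> (x + (- y))" UNIV]
      by (simp only: iter_diff_mult_left iter_diff_translate)
    also have "[\<dots> = (\<Sum>y\<in>UNIV. g y * c)] (mod int p)"
      by (intro cong_sum cong_mult cong_refl const)
    finally show ?thesis by (simp add: sum_distrib_left mult.commute)
  qed
  have "\<not> int p dvd c"
    using cong_dvd_iff[OF cong[of g0 x0]] nz by auto
  show ?thesis
    by (rule that[OF as \<open>\<not> int p dvd c\<close> _ cong]) (use D d in simp)
qed

section \<open>Passage to vectors, one coordinate at a time\<close>

lemma iter_diff_map_hom:
  assumes "\<And>a b. h (a + b) = h a + h b"
  shows "iter_diff (map h as) g (x + h b) = iter_diff as (\<lambda>a. g (x + h a)) b"
proof (induction as arbitrary: b)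
  case (Cons a as)
  have shift: "x + h b + h a = x + h (b + a)" by (simp add: assms add.assoc)
  show ?case by (simp add: shift Cons)
qed simp

lemma axis_plus: "axis i (a + b) = axis i a + axis i (b :: 'a::monoid_add)"
  by (simp add: vec_eq_iff axis_def)

text \<open>A vector supported in \<open>insert i S\<close> splits uniquely into its
  \<open>i\<close>-th coordinate and a vector supported in \<open>S\<close>.\<close>

lemma sum_supported_insert:
  fixes g :: "'a::{finite,ab_group_add} ^ 'n::finite \<Rightarrow> 'b::comm_monoid_add"
  assumes "i \<notin> S"
  shows "(\<Sum>y | \<forall>j. j \<notin> insert i S \<longrightarrow> y $ j = 0. g y) =
    (\<Sum>a\<in>UNIV. \<Sum>y | \<forall>j. j \<notin> S \<longrightarrow> y $ j = 0. g (axis i a + y))"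
proof -
  have axis_component: "axis i a $ j = (if j = i then a else 0)" for a :: 'a and j
    by (simp add: axis_def)
  have split: "axis i (z $ i) + (\<chi> j. if j = i then 0 else z $ j) = z" for z :: "'a ^ 'n"
    by (simp add: vec_eq_iff axis_component)
  show ?thesis
    unfolding sum.cartesian_product
    by (rule sum.reindex_bij_witness[of _ "\<lambda>(a, y). axis i a + y"
          "\<lambda>z. (z $ i, \<chi> j. if j = i then 0 else z $ j)"])
      (use assms in \<open>auto simp: split vec_eq_iff axis_component\<close>)
qed

text \<open>Each coordinate in \<open>S\<close> receives its own copy of \<open>as\<close>, which
  contributes a factor \<open>c\<close> and the summation over that coordinate.\<close>

lemma iter_diff_cong_sum_vec:
  fixes as :: "'a::{finite,ab_group_add} list" and S :: "'n::finite set"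
  assumes "\<And>g x. [iter_diff as g x = c * (\<Sum>y\<in>UNIV. g y)] (mod q)"
  shows "\<exists>bs. length bs = length as * card S \<and> (\<forall>g x. [iter_diff bs g x =
    c ^ card S * (\<Sum>y :: 'a ^ 'n | \<forall>j. j \<notin> S \<longrightarrow> y $ j = 0. g (x + y))] (mod q))"
proof (induction S rule: finite_induct[OF finite])
  case 1
  have "{y :: 'a ^ 'n. \<forall>j. y $ j = 0} = {0}" by (auto simp: vec_eq_iff)
  then show ?case by auto
next
  case (2 i S)
  let ?H = "\<lambda>S. {y :: 'a ^ 'n. \<forall>j. j \<notin> S \<longrightarrow> y $ j = 0}"
  obtain bs where len: "length bs = length as * card S"
    and bs: "\<And>g x. [iter_diff bs g x = c ^ card S * (\<Sum>y\<in>?H S. g (x + y))] (mod q)"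
    using 2 by blast
  have "[iter_diff (map (axis i) as @ bs) g x =
      c ^ card (insert i S) * (\<Sum>y\<in>?H (insert i S). g (x + y))] (mod q)" for g x
  proof -
    have axis_0: "axis i 0 = (0 :: 'a ^ 'n)" by (simp add: vec_eq_iff axis_def)
    have "iter_diff (map (axis i) as @ bs) g x =
        iter_diff as (\<lambda>a. iter_diff bs g (x + axis i a)) 0"
      using iter_diff_map_hom[of "axis i" as "iter_diff bs g" x 0]
      by (simp add: axis_0 axis_plus iter_diff_append)
    also have "[\<dots> = c * (\<Sum>a\<in>UNIV. iter_diff bs g (x + axis i a))] (mod q)"
      by (rule assms)
    also have "[c * (\<Sum>a\<in>UNIV. iter_diff bs g (x + axis i a)) =
        c * (\<Sum>a\<in>UNIV. c ^ card S * (\<Sum>y\<in>?H S. g (x + axis i a + y)))] (mod q)"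
      by (intro cong_mult cong_refl cong_sum bs)
    also have "c * (\<Sum>a\<in>UNIV. c ^ card S * (\<Sum>y\<in>?H S. g (x + axis i a + y))) =
        c ^ card (insert i S) * (\<Sum>y\<in>?H (insert i S). g (x + y))"
      by (simp only: sum_supported_insert[OF 2(2)] card_insert_disjoint[OF 2(1,2)] power_Suc
          sum_distrib_left add.assoc mult.assoc)
    finally show ?thesis .
  qed
  then show ?case
    using len 2 by (intro exI[of _ "map (axis i) as @ bs"]) auto
qed

section \<open>Counting the zeros modulo \<open>p\<close>\<close>

theorem theorem11p3:
  fixes p r :: nat
    and f :: "nat \<Rightarrow> 'a::{finite, ab_group_add} ^ 'n::finite \<Rightarrow> 'a"
  assumes "prime p"
    and "\<exists>k. CARD('a) = p ^ k"
    and "CARD('a) > 1"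
    and "r \<ge> 1"
    and "enat CARD('n) > (\<Sum>i = 1..r. Fdeg (f i))"
  shows "p dvd card {a :: 'a ^ 'n. \<forall>i\<in>{1..r}. f i a = 0}"
proof -
  let ?V = "{a :: 'a ^ 'n. \<forall>i\<in>{1..r}. f i a = 0}"
  obtain k where k: "CARD('a) = p ^ k" using assms(2) by blast
  obtain as :: "'a list" and c d where as: "length as = Suc d" and c: "\<not> int p dvd c"
    and deg: "\<And>g :: 'a \<Rightarrow> int. deg_less_mod (int p) (Suc (Suc d)) g"
    and cong: "\<And>g x. [iter_diff as g x = c * (\<Sum>y\<in>UNIV. g y)] (mod int p)"
    by (rule exists_iter_diff_cong_sum[OF assms(1) k assms(3)]) (rule that)
  \<comment> \<open>The sum of the degrees is below a finite bound, so each degree is finite and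
    \<open>the_enat\<close> returns it.\<close>
  define m where "m i = the_enat (Fdeg (f i))" for i
  have m: "Fdeg (f i) = enat (m i)" if "i \<in> {1..r}" for i
  proof -
    have "Fdeg (f i) \<le> (\<Sum>i = 1..r. Fdeg (f i))"
      by (rule member_le_sum) (use that in auto)
    from le_less_trans[OF this assms(5)] show ?thesis
      by (cases "Fdeg (f i)") (auto simp: m_def)
  qed
  have "(\<Sum>i = 1..r. Fdeg (f i)) = enat (\<Sum>i = 1..r. m i)"
    by (simp add: m flip: of_nat_eq_enat)
  with assms(5) have lt: "(\<Sum>i = 1..r. m i) < CARD('n)" by simp
  define F :: "'a ^ 'n \<Rightarrow> int" where "F x = (\<Prod>i = 1..r. if f i x = 0 then 1 else 0)" for x
  have "deg_less_mod (int p) (Suc (\<Sum>i = 1..r. m i * Suc d)) F"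
    unfolding F_def
  proof (rule deg_less_mod_prod)
    fix i assume "i \<in> {1..r}"
    then show "deg_less_mod (int p) (Suc (m i * Suc d)) (\<lambda>x. if f i x = 0 then 1 else 0)"
      using Fdeg_imp_iter_diff_eq_0[OF m]
      by (intro deg_less_mod_comp[where g = "\<lambda>y. if y = 0 then 1 else 0"] deg) auto
  qed simp
  moreover have "Suc (\<Sum>i = 1..r. m i * Suc d) \<le> Suc d * CARD('n)"
  proof -
    \<comment> \<open>The gap of at least \<open>1\<close> between the degree sum and the number of
      coordinates grows to \<open>Suc d\<close>, which covers the outer \<open>Suc\<close>.\<close>
    have "Suc d * Suc (\<Sum>i = 1..r. m i) \<le> Suc d * CARD('n)"
      using lt by (intro mult_le_mono2) simp
    then show ?thesis by (simp add: sum_distrib_left algebra_simps sum.distrib)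
  qed
  ultimately have F: "deg_less_mod (int p) (Suc d * CARD('n)) F"
    by (rule deg_less_mod_mono)
  obtain bs :: "('a ^ 'n) list" where bs: "length bs = length as * CARD('n) \<and>
      (\<forall>g x. [iter_diff bs g x = c ^ CARD('n) *
        (\<Sum>y | \<forall>j. j \<notin> UNIV \<longrightarrow> y $ j = 0. g (x + y))] (mod int p))"
    using iter_diff_cong_sum_vec[OF cong, of "UNIV :: 'n set"] ..
  then have "[iter_diff bs F 0 = c ^ CARD('n) *
      (\<Sum>y | \<forall>j. j \<notin> UNIV \<longrightarrow> y $ j = 0. F (0 + y))] (mod int p)"
    by blast
  then have cong_F: "[iter_diff bs F 0 = c ^ CARD('n) * (\<Sum>y\<in>UNIV. F y)] (mod int p)"
    by simp
  from F bs as have "int p dvd iter_diff bs F 0" by (simp add: deg_less_mod_def)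
  then have "int p dvd c ^ CARD('n) * (\<Sum>y\<in>UNIV. F y)"
    using cong_dvd_iff[OF cong_F] by blast
  moreover have "prime (int p)" using assms(1) by simp
  moreover from this have "\<not> int p dvd c ^ CARD('n)"
    using c prime_dvd_power by blast
  ultimately have "int p dvd (\<Sum>y\<in>UNIV. F y)"
    using prime_dvd_mult_iff by blast
  also have "(\<Sum>y\<in>UNIV. F y) = (\<Sum>y\<in>UNIV. if y \<in> ?V then 1 else 0)"
  proof (rule sum.cong)
    show "F y = (if y \<in> ?V then 1 else 0)" for y
    proof (cases "y \<in> ?V")
      case True
      then show ?thesis by (simp add: F_def)
    next
      case False
      then show ?thesis by (auto simp: F_def prod_zero_iff)
    qed
  qed simp
  also have "\<dots> = int (card ?V)" by (simp flip: sum.inter_filter)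
  finally show ?thesis by simp
qed

end
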